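(* For any pair $\mathcal{I},\mathcal{G}\subseteq 2^\omega$ such that (a) $\mathcal{I}$ is countable and downwards $\le_e$-closed; (b) $\mathcal{G}\subseteq 2^\omega\smallsetminus\mathcal{I}$ is countable and closed under $\equiv_e$, there exists a pair of countable sets $\mathcal{I}_f,\mathcal{G}_f\subseteq 2^\omega$ such that $\mathcal{I}_f\supseteq\mathcal{I}$, $\mathcal{G}_f\supseteq\mathcal{G}$, $\mathcal{I}_f$ is downwards $\le_e$-closed, $\mathcal{G}_f$ is closed under $\equiv_e$, $\mathcal{G}_f\subseteq 2^\omega\smallsetminus\mathcal{I}_f$, and $\mathcal{I}_f$ forms a splitting class (with respect to $\le_e$).
   Context: An enumeration operator is a map $\Phi:2^\omega\to 2^\omega$ given by a c.e. set $W$ via $\Phi(A)=\{x:(\exists u)[\langle x,u\rangle\in W\ \&\ D_u\subseteq A]\}$, $D_u$ being the finite set with canonical index $u$. $A\le_e B$ iff $A=\Phi(B)$ for some enumeration operator $\Phi$; $A\equiv_e B$ iff $A\le_e B$ and $B\le_e A$; $A<_e B$ iff $A\le_e B$ and $B\nleq_e A$. $A\oplus B=\{2x:x\in A\}\cup\{2x+1:x\in B\}$. A class $\mathcal{A}\subseteq 2^\omega$ is downwards $\le_e$-closed if $X\le_e Y\in\mathcal{A}$ implies $X\in\mathcal{A}$. A nonempty, countable, downwards $\le_e$-closed class $\mathcal{A}\subseteq 2^\omega$ is a splitting class if for every $A\in\mathcal{A}$ and every finite $\mathcal{B}\subseteq\{B\in\mathcal{A}:B\nleq_e A\}$ there is $C\in\mathcal{A}$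 with $C>_e A$ such that $B\oplus C\notin\mathcal{A}$ for all $B\in\mathcal{B}$.
   Formalization: When I is empty, it is additionally assumed that the empty set is not in G; otherwise the claim fails (I empty, G all c.e. sets), since every splitting class contains the empty set. *)

theory Defs
  imports "HOL-Library.Countable_Set" "HOL-Library.Nat_Bijection"
begin

(* Kleene's partial recursive functions. Programs carry no arity: a clause that needs more
   arguments than the list supplies is undefined, and Zero and the projections serve every arity.
   For each n, the restrictions of programs to lists of length n are exactly the partial recursive
   functions of n variables. *)

datatype recf =
    Zero
  | Succ
  | Proj nat
  | Comp recf "recf list"
  | PrimRec recf recf
  | Mu recf

fun recf_eval :: "recf \<Rightarrow> nat list \<Rightarrow> nat option" where
  "recf_eval Zero xs = Some 0"
| "recf_eval Succ xs = (case xs of [x] \<Rightarrow> Some (Suc x) | _ \<Rightarrow> None)"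
| "recf_eval (Proj i) xs = (if i < length xs then Some (xs ! i) else None)"
| "recf_eval (Comp f gs) xs =
     (if \<forall>g\<in>set gs. recf_eval g xs \<noteq> None
      then recf_eval f (map (\<lambda>g. the (recf_eval g xs)) gs) else None)"
| "recf_eval (PrimRec f g) xs =
     (case xs of [] \<Rightarrow> None
      | n # ys \<Rightarrow> rec_nat (recf_eval f ys)
          (\<lambda>k r. case r of None \<Rightarrow> None | Some v \<Rightarrow> recf_eval g (k # v # ys)) n)"
| "recf_eval (Mu f) xs =
     (if \<exists>n. recf_eval f (n # xs) = Some 0 \<and> (\<forall>k<n. recf_eval f (k # xs) \<noteq> None)
      then Some (LEAST n. recf_eval f (n # xs) = Some 0) else None)"

definition ce :: "nat set \<Rightarrow> bool" where
  "ce W \<longleftrightarrow> (\<exists>p. W = {x. recf_eval p [x] \<noteq> None})"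

(* set_decode u is the finite set with canonical index u, i.e. u is the sum of 2 ^ x over its
   elements x; prod_encode is Cantor's pairing function. *)

definition enum_op :: "nat set \<Rightarrow> nat set \<Rightarrow> nat set" where
  "enum_op W A = {x. \<exists>u. prod_encode (x, u) \<in> W \<and> set_decode u \<subseteq> A}"

definition enumeration_operator :: "(nat set \<Rightarrow> nat set) \<Rightarrow> bool" where
  "enumeration_operator \<Phi> \<longleftrightarrow> (\<exists>W. ce W \<and> \<Phi> = enum_op W)"

definition e_le :: "nat set \<Rightarrow> nat set \<Rightarrow> bool"  (infix "\<le>\<^sub>e" 50) where
  "A \<le>\<^sub>e B \<longleftrightarrow> (\<exists>\<Phi>. enumeration_operator \<Phi> \<and> A = \<Phi> B)"

definition e_equiv :: "nat set \<Rightarrow> nat set \<Rightarrow> bool"  (infix "\<equiv>\<^sub>e" 50) where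
  "A \<equiv>\<^sub>e B \<longleftrightarrow> A \<le>\<^sub>e B \<and> B \<le>\<^sub>e A"

definition e_less :: "nat set \<Rightarrow> nat set \<Rightarrow> bool"  (infix "<\<^sub>e" 50) where
  "A <\<^sub>e B \<longleftrightarrow> A \<le>\<^sub>e B \<and> \<not> B \<le>\<^sub>e A"

definition e_join :: "nat set \<Rightarrow> nat set \<Rightarrow> nat set"  (infixl "\<oplus>\<^sub>e" 65) where
  "A \<oplus>\<^sub>e B = {2 * x | x. x \<in> A} \<union> {2 * x + 1 | x. x \<in> B}"

definition e_downward_closed :: "nat set set \<Rightarrow> bool" where
  "e_downward_closed \<A> \<longleftrightarrow> (\<forall>X Y. X \<le>\<^sub>e Y \<and> Y \<in> \<A> \<longrightarrow> X \<in> \<A>)"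

definition e_equiv_closed :: "nat set set \<Rightarrow> bool" where
  "e_equiv_closed \<A> \<longleftrightarrow> (\<forall>X Y. X \<equiv>\<^sub>e Y \<and> Y \<in> \<A> \<longrightarrow> X \<in> \<A>)"

definition splitting_class :: "nat set set \<Rightarrow> bool" where
  "splitting_class \<A> \<longleftrightarrow>
     \<A> \<noteq> {} \<and> countable \<A> \<and> e_downward_closed \<A> \<and>
     (\<forall>A\<in>\<A>. \<forall>\<B>. finite \<B> \<and> \<B> \<subseteq> {B \<in> \<A>. \<not> B \<le>\<^sub>e A} \<longrightarrow>
        (\<exists>C\<in>\<A>. A <\<^sub>e C \<and> (\<forall>B\<in>\<B>. B \<oplus>\<^sub>e C \<notin> \<A>)))"

(* A splitting class is nonempty and downwards closed, so it contains the empty set. Hence a class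
   \<G> can be kept disjoint from some splitting class only if {} is not in \<G>. When \<G> is disjoint
   from a nonempty downwards closed \<I>, this is automatic; for \<I> = {} it has to be assumed. *)

end

theory Submission
  imports Defs
begin

text \<open>The classes are enlarged step by step, one instance of the splitting property at a time,
  while a second, growing collection records the sets that must never enter the class. Suppose \<open>A\<close>
  and finitely many \<open>B\<close> are given in the current class, with no \<open>B\<close> reducible to \<open>A\<close>. No set
  of the second collection is reducible to \<open>A\<close> either, as the class is downwards closed. Let
  \<open>C = A \<oplus>\<^sub>e R\<close> for a set \<open>R\<close> that is sufficiently generic relative to these countably many
  sets. By \<open>generic_join_avoids\<close> none of them is reducible to \<open>C\<close>, and \<open>C\<close> is not in the
  class. So the lower cone of \<open>C\<close> can be added to the class and the degrees of the joins
  \<open>B \<oplus>\<^sub>e C\<close> to the second collection without a conflict (\<open>meet_demand\<close>). Since the class is not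
  required to be closed under joins, nothing more has to be added. There are countably many
  instances at each point, and two nested iterations of length \<open>\<omega>\<close> take care of all of them, as
  the two properties of being downwards closed and of avoiding the second collection
  pass to unions of chains (\<open>meet_all_demands\<close>, \<open>extends_to_splitting_class\<close>).

  The genericity argument uses three facts about enumeration reducibility: an enumeration operator
  is monotone and acts through finite sets, the join of \<open>A\<close> with a cofinite set is reducible to
  \<open>A\<close>, and reducibility is transitive. The last one is where computability theory enters. To
  compose two operators one has to know that c.e. sets, given as domains of programs, are
  projections of decidable relations. This is proved by evaluating programs in stages, where only
  unbounded search is cut off (\<open>staged_eval\<close>).\<close>

section \<open>Computable functions and decidable relations\<close>

text \<open>A program carries no arity, so computability is stated relative to the length of the argument
  list. A function of a list is read as a term whose free variables are the entries, the innermost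
  bound variable at the head: binding a variable is consing onto the list, and a variable is
  reached by \<^term>\<open>hd\<close> after some number of \<^term>\<open>tl\<close>. In this form the closure rules for
  terms and formulas apply by syntactic matching.\<close>

definition computable :: "nat \<Rightarrow> (nat list \<Rightarrow> nat) \<Rightarrow> bool" where
  "computable n f \<longleftrightarrow> (\<exists>p. \<forall>xs. length xs = n \<longrightarrow> recf_eval p xs = Some (f xs))"

definition computable_list :: "nat \<Rightarrow> nat \<Rightarrow> (nat list \<Rightarrow> nat list) \<Rightarrow> bool" where
  "computable_list n m L \<longleftrightarrow>
     (\<forall>xs. length xs = n \<longrightarrow> length (L xs) = m) \<and> (\<forall>i<m. computable n (\<lambda>xs. L xs ! i))"

text \<open>Truth is the value 0, the value that unbounded search looks for. Any computable function
  with the right zero set serves, which makes conjunction an addition.\<close>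

definition decidable :: "nat \<Rightarrow> (nat list \<Rightarrow> bool) \<Rightarrow> bool" where
  "decidable n P \<longleftrightarrow>
     (\<exists>f. computable n f \<and> (\<forall>xs. length xs = n \<longrightarrow> (P xs \<longleftrightarrow> f xs = 0)))"

lemma computable_cong:
  assumes "computable n f" "\<And>xs. length xs = n \<Longrightarrow> f xs = g xs"
  shows "computable n g"
  using assms unfolding computable_def by (metis (no_types, lifting))

lemma decidable_cong:
  assumes "decidable n P" "\<And>xs. length xs = n \<Longrightarrow> P xs \<longleftrightarrow> Q xs"
  shows "decidable n Q"
  using assms unfolding decidable_def by (metis (no_types, lifting))

lemma computable_nth: "i < n \<Longrightarrow> computable n (\<lambda>xs. xs ! i)"
  unfolding computable_def by (rule exI[of _ "Proj i"]) simp

lemma computable_comp: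
  assumes L: "computable_list n m L" and f: "computable m f"
  shows "computable n (\<lambda>xs. f (L xs))"
proof -
  obtain p where p: "\<And>xs. length xs = m \<Longrightarrow> recf_eval p xs = Some (f xs)"
    using f unfolding computable_def by blast
  have "\<forall>i. \<exists>q. i < m \<longrightarrow> (\<forall>xs. length xs = n \<longrightarrow> recf_eval q xs = Some (L xs ! i))"
    using L unfolding computable_list_def computable_def by blast
  then obtain q where
    q: "\<And>i xs. i < m \<Longrightarrow> length xs = n \<Longrightarrow> recf_eval (q i) xs = Some (L xs ! i)"
    by metis
  have "recf_eval (Comp p (map q [0..<m])) xs = Some (f (L xs))" if "length xs = n" for xs
  proof -
    have "map (\<lambda>g. the (recf_eval g xs)) (map q [0..<m]) = L xs"
      using L that q by (intro nth_equalityI) (auto simp: computable_list_def)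
    moreover have "length (L xs) = m"
      using L that by (simp add: computable_list_def)
    ultimately show ?thesis
      using q that p[of "L xs"] by auto
  qed
  then show ?thesis
    unfolding computable_def by blast
qed

lemma decidable_comp:
  assumes "computable_list n m L" and "decidable m P"
  shows "decidable n (\<lambda>xs. P (L xs))"
  using assms computable_comp[OF assms(1)]
  unfolding decidable_def computable_list_def by blast

lemma computable_list_Nil: "computable_list n 0 (\<lambda>_. [])"
  by (simp add: computable_list_def)

lemma computable_list_Cons:
  assumes "computable n f" "computable_list n m L"
  shows "computable_list n (Suc m) (\<lambda>xs. f xs # L xs)"
  using assms by (auto simp: computable_list_def nth_Cons less_Suc_eq_0_disj split: nat.split)

lemma computable_list_tl:
  assumes L: "computable_list n (Suc m) L"
  shows "computable_list n m (\<lambda>xs. tl (L xs))"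
proof -
  have "computable n (\<lambda>xs. tl (L xs) ! i)" if "i < m" for i
    by (rule computable_cong[of n "\<lambda>xs. L xs ! Suc i"])
      (use L that in \<open>auto simp: computable_list_def nth_tl\<close>)
  then show ?thesis
    using L by (auto simp: computable_list_def)
qed

lemma computable_list_id: "computable_list n n (\<lambda>xs. xs)"
  by (simp add: computable_list_def computable_nth)

lemma computable_tl: "computable n f \<Longrightarrow> computable (Suc n) (\<lambda>xs. f (tl xs))"
  by (rule computable_comp[OF computable_list_tl[OF computable_list_id]])

lemma computable_hd: "0 < n \<Longrightarrow> computable n hd"
  by (rule computable_cong[OF computable_nth[of 0]]) (auto simp: hd_conv_nth)

lemma computable_projections:
  shows "computable (Suc n) (\<lambda>xs. hd xs)"
  and "computable (Suc (Suc n)) (\<lambda>xs. hd (tl xs))"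
  and "computable (Suc (Suc (Suc n))) (\<lambda>xs. hd (tl (tl xs)))"
  and "computable (Suc (Suc (Suc (Suc n)))) (\<lambda>xs. hd (tl (tl (tl xs))))"
  and "computable (Suc (Suc (Suc (Suc (Suc n))))) (\<lambda>xs. hd (tl (tl (tl (tl xs)))))"
  and "computable (Suc (Suc (Suc (Suc (Suc (Suc n)))))) (\<lambda>xs. hd (tl (tl (tl (tl (tl xs))))))"
proof -
  have *: "computable (k + Suc n) (\<lambda>xs. hd ((tl ^^ k) xs))" for k n
  proof (induction k)
    case (Suc k)
    from computable_tl[OF this] show ?case
      by (simp add: funpow_swap1)
  qed (simp add: computable_hd)
  show "computable (Suc n) (\<lambda>xs. hd xs)"
    "computable (Suc (Suc n)) (\<lambda>xs. hd (tl xs))"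
    "computable (Suc (Suc (Suc n))) (\<lambda>xs. hd (tl (tl xs)))"
    "computable (Suc (Suc (Suc (Suc n)))) (\<lambda>xs. hd (tl (tl (tl xs))))"
    "computable (Suc (Suc (Suc (Suc (Suc n))))) (\<lambda>xs. hd (tl (tl (tl (tl xs)))))"
    "computable (Suc (Suc (Suc (Suc (Suc (Suc n)))))) (\<lambda>xs. hd (tl (tl (tl (tl (tl xs))))))"
    using *[of 0 n] *[of 1 n] *[of 2 n] *[of 3 n] *[of 4 n] *[of 5 n]
    by (simp_all add: eval_nat_numeral)
qed

lemma computable_Suc: "computable n f \<Longrightarrow> computable n (\<lambda>xs. Suc (f xs))"
proof -
  assume "computable n f"
  moreover have "computable (Suc 0) (\<lambda>ys. Suc (hd ys))"
    unfolding computable_def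
    by (rule exI[of _ Succ]) (auto simp: length_Suc_conv)
  ultimately show ?thesis
    using computable_comp[OF computable_list_Cons[OF _ computable_list_Nil]] by fastforce
qed

lemma computable_const: "computable n (\<lambda>_. c)"
proof (induction c)
  case 0
  show ?case
    unfolding computable_def by (rule exI[of _ Zero]) simp
qed (rule computable_Suc)

lemma computable_rec:
  assumes a: "computable n a" and z: "computable n z"
    and s: "computable (Suc (Suc n)) (\<lambda>xs. s (hd xs) (hd (tl xs)) (tl (tl xs)))"
  shows "computable n (\<lambda>xs. rec_nat (z xs) (\<lambda>k r. s k r xs) (a xs))"
proof -
  obtain p where p: "\<And>xs. length xs = n \<Longrightarrow> recf_eval p xs = Some (z xs)"
    using z unfolding computable_def by blast
  obtain q where q: "\<And>k r xs. length xs = n \<Longrightarrow> recf_eval q (k # r # xs) = Some (s k r xs)"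
    using s unfolding computable_def
    by (metis length_Cons list.sel(1) list.sel(3))
  have "recf_eval (PrimRec p q) xs = Some (rec_nat (z (tl xs)) (\<lambda>k r. s k r (tl xs)) (hd xs))"
    if len: "length xs = Suc n" for xs
  proof -
    obtain m ys where xs: "xs = m # ys" "length ys = n"
      using len by (auto simp: length_Suc_conv)
    have "rec_nat (recf_eval p ys)
            (\<lambda>k r. case r of None \<Rightarrow> None | Some v \<Rightarrow> recf_eval q (k # v # ys)) m =
          Some (rec_nat (z ys) (\<lambda>k r. s k r ys) m)" for m
      by (induction m) (simp_all add: p q xs)
    then show ?thesis
      by (simp add: xs)
  qed
  then have "computable (Suc n)
      (\<lambda>xs. rec_nat (z (tl xs)) (\<lambda>k r. s k r (tl xs)) (hd xs))"
    unfolding computable_def by blast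
  from computable_comp[OF computable_list_Cons[OF a computable_list_id] this]
  show ?thesis
    by simp
qed

lemma computable_binary:
  assumes "computable (Suc (Suc 0)) (\<lambda>xs. F (hd xs) (hd (tl xs)))"
    and "computable n f" "computable n g"
  shows "computable n (\<lambda>xs. F (f xs) (g xs))"
  using computable_comp[OF computable_list_Cons[OF assms(2)
        computable_list_Cons[OF assms(3) computable_list_Nil]] assms(1)]
  by simp

lemma decidable_binary:
  assumes "decidable (Suc (Suc 0)) (\<lambda>xs. P (hd xs) (hd (tl xs)))"
    and "computable n f" "computable n g"
  shows "decidable n (\<lambda>xs. P (f xs) (g xs))"
  using decidable_comp[OF computable_list_Cons[OF assms(2)
        computable_list_Cons[OF assms(3) computable_list_Nil]] assms(1)]
  by simp

lemma computable_add:
  assumes "computable n f" "computable n g"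
  shows "computable n (\<lambda>xs. f xs + g xs)"
proof -
  have "rec_nat a (\<lambda>k r. Suc r) b = a + b" for a b
    by (induction b) auto
  with computable_rec[OF assms(2,1) computable_Suc[OF computable_projections(2)]]
  show ?thesis by simp
qed

lemma computable_mult:
  assumes "computable n f" "computable n g"
  shows "computable n (\<lambda>xs. f xs * g xs)"
proof -
  have "rec_nat 0 (\<lambda>k r. r + a) b = a * b" for a b :: nat
    by (induction b) auto
  with computable_rec[OF assms(2) computable_const[of _ 0]
      computable_add[OF computable_projections(2) computable_tl[OF computable_tl[OF assms(1)]]]]
  show ?thesis by simp
qed

lemma computable_power:
  assumes "computable n f" "computable n g"
  shows "computable n (\<lambda>xs. f xs ^ g xs)"
proof -
  have "rec_nat 1 (\<lambda>k r. r * a) b = a ^ b" for a b :: nat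
    by (induction b) auto
  with computable_rec[OF assms(2) computable_const[of _ 1]
      computable_mult[OF computable_projections(2) computable_tl[OF computable_tl[OF assms(1)]]]]
  show ?thesis by simp
qed

lemma computable_diff:
  assumes "computable n f" "computable n g"
  shows "computable n (\<lambda>xs. f xs - g xs)"
proof -
  have pred: "computable m (\<lambda>xs. h xs - Suc 0)" if "computable m h" for m h
  proof -
    have "rec_nat 0 (\<lambda>k r. k) b = b - Suc 0" for b
      by (cases b) auto
    with computable_rec[OF that computable_const[of _ 0] computable_projections(1)] show ?thesis
      by simp
  qed
  have "rec_nat a (\<lambda>k r. r - Suc 0) b = a - b" for a b
    by (induction b) auto
  with computable_rec[OF assms(2,1) pred[OF computable_projections(2)]]
  show ?thesis by simp
qed

lemma decidable_le:
  assumes "computable n f" "computable n g"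
  shows "decidable n (\<lambda>xs. f xs \<le> g xs)"
  using computable_diff[OF assms] unfolding decidable_def by force

lemma decidable_not:
  assumes "decidable n P"
  shows "decidable n (\<lambda>xs. \<not> P xs)"
proof -
  obtain f where f: "computable n f" "\<And>xs. length xs = n \<Longrightarrow> P xs \<longleftrightarrow> f xs = 0"
    using assms unfolding decidable_def by blast
  have "decidable n (\<lambda>xs. 1 \<le> f xs)"
    by (rule decidable_le[OF computable_const f(1)])
  then show ?thesis
    by (rule decidable_cong) (use f(2) in auto)
qed

lemma decidable_conj:
  assumes "decidable n P" "decidable n Q"
  shows "decidable n (\<lambda>xs. P xs \<and> Q xs)"
proof -
  obtain f g where "computable n f" "\<And>xs. length xs = n \<Longrightarrow> P xs \<longleftrightarrow> f xs = 0"
      "computable n g" "\<And>xs. length xs = n \<Longrightarrow> Q xs \<longleftrightarrow> g xs = 0"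
    using assms unfolding decidable_def by blast
  then show ?thesis
    using computable_add[of n f g] unfolding decidable_def by fastforce
qed

lemma decidable_disj:
  assumes "decidable n P" "decidable n Q"
  shows "decidable n (\<lambda>xs. P xs \<or> Q xs)"
  using decidable_not[OF decidable_conj[OF decidable_not decidable_not], OF assms] by simp

lemma decidable_imp:
  assumes "decidable n P" "decidable n Q"
  shows "decidable n (\<lambda>xs. P xs \<longrightarrow> Q xs)"
  unfolding imp_conv_disj by (intro decidable_disj decidable_not assms)

lemma decidable_eq:
  assumes "computable n f" "computable n g"
  shows "decidable n (\<lambda>xs. f xs = g xs)"
  using decidable_conj[OF decidable_le[OF assms] decidable_le[OF assms(2,1)]]
  by (simp add: order_eq_iff)

lemma computable_If:
  assumes P: "decidable n P" and f: "computable n f" and g: "computable n g"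
  shows "computable n (\<lambda>xs. if P xs then f xs else g xs)"
proof -
  obtain c where c: "computable n c" "\<And>xs. length xs = n \<Longrightarrow> P xs \<longleftrightarrow> c xs = 0"
    using P unfolding decidable_def by blast
  have "computable n (\<lambda>xs. (1 - c xs) * f xs + (1 - (1 - c xs)) * g xs)"
    by (intro computable_add computable_mult computable_diff computable_const c f g)
  then show ?thesis
    by (rule computable_cong) (use c(2) in auto)
qed

text \<open>Searching over all numbers yields a total function once a solution always exists. This one
  rule replaces explicit recursions for bounded quantifiers, for division and for the bounded
  search in the stagewise evaluation below.\<close>

lemma computable_Least:
  assumes P: "decidable (Suc n) (\<lambda>xs. P (hd xs) (tl xs))"
    and ex: "\<And>xs. length xs = n \<Longrightarrow> \<exists>k. P k xs"
  shows "computable n (\<lambda>xs. LEAST k. P k xs)"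
proof -
  obtain f p where f: "\<And>k xs. length xs = n \<Longrightarrow> P k xs \<longleftrightarrow> f (k # xs) = 0"
    and p: "\<And>k xs. length xs = n \<Longrightarrow> recf_eval p (k # xs) = Some (f (k # xs))"
    using P unfolding decidable_def computable_def
    by (metis length_Cons list.sel(1) list.sel(3))
  have "recf_eval (Mu p) xs = Some (LEAST k. P k xs)" if "length xs = n" for xs
    using ex[OF that] f[OF that] p[OF that] by auto
  then show ?thesis
    unfolding computable_def by blast
qed

text \<open>The least \<open>k\<close> that is either the bound or a witness always exists, and it is a witness iff
  there is one up to the bound.\<close>

lemma decidable_ex_le:
  assumes P: "decidable (Suc n) (\<lambda>xs. P (hd xs) (tl xs))" and a: "computable n a"
  shows "decidable n (\<lambda>xs. \<exists>k\<le>a xs. P k xs)"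
proof -
  let ?m = "\<lambda>xs. LEAST k. k = a xs \<or> P k xs"
  have "computable n ?m"
    by (rule computable_Least)
      (auto intro!: decidable_disj decidable_eq computable_projections computable_tl P a)
  from decidable_comp[OF computable_list_Cons[OF this computable_list_id] P]
  have "decidable n (\<lambda>xs. P (?m xs) xs)"
    by simp
  then show ?thesis
  proof (rule decidable_cong)
    fix xs
    have m: "?m xs = a xs \<or> P (?m xs) xs"
      by (rule LeastI[of _ "a xs"]) simp
    have le: "?m xs \<le> k" if "k = a xs \<or> P k xs" for k
      by (rule Least_le) (rule that)
    show "P (?m xs) xs \<longleftrightarrow> (\<exists>k\<le>a xs. P k xs)"
      using m le by (metis le_antisym le_cases)
  qed
qed

lemma decidable_all_le:
  assumes "decidable (Suc n) (\<lambda>xs. P (hd xs) (tl xs))" "computable n a"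
  shows "decidable n (\<lambda>xs. \<forall>k\<le>a xs. P k xs)"
  using decidable_not[OF decidable_ex_le[OF decidable_not, OF assms]] by simp

lemma computable_div:
  assumes "computable n f" "computable n g"
  shows "computable n (\<lambda>xs. f xs div g xs)"
proof -
  have "computable (Suc (Suc 0))
      (\<lambda>xs. LEAST q. hd (tl xs) = 0 \<or> Suc (hd xs) \<le> Suc q * hd (tl xs))"
  proof (rule computable_Least)
    show "\<exists>q. hd (tl xs) = 0 \<or> Suc (hd xs) \<le> Suc q * hd (tl xs)" for xs :: "nat list"
      by (rule exI[of _ "hd xs"]) (cases "hd (tl xs)"; simp)
  qed (intro decidable_disj decidable_le decidable_eq computable_mult computable_Suc
      computable_const computable_projections)
  then have "computable (Suc (Suc 0)) (\<lambda>xs. hd xs div hd (tl xs))"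
  proof (rule computable_cong)
    fix xs :: "nat list"
    define x y where "x = hd xs" and "y = hd (tl xs)"
    show "(LEAST q. hd (tl xs) = 0 \<or> Suc (hd xs) \<le> Suc q * hd (tl xs)) = hd xs div hd (tl xs)"
      unfolding x_def[symmetric] y_def[symmetric]
    proof (cases "y = 0")
      case False
      then show "(LEAST q. y = 0 \<or> Suc x \<le> Suc q * y) = x div y"
        by (intro Least_equality)
          (simp_all add: Suc_le_eq less_Suc_eq_le flip: div_less_iff_less_mult del: mult_Suc)
    qed auto
  qed
  then show ?thesis
    using assms by (rule computable_binary)
qed

lemma computable_prod_encode:
  assumes "computable n f" "computable n g"
  shows "computable n (\<lambda>xs. prod_encode (f xs, g xs))"
  unfolding prod_encode_def triangle_def prod.case
  by (intro computable_add computable_div computable_mult computable_Suc computable_const assms)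

lemma decidable_mem_set_decode:
  assumes "computable n f" "computable n g"
  shows "decidable n (\<lambda>xs. f xs \<in> set_decode (g xs))"
proof -
  have odd: "odd m \<longleftrightarrow> \<not> m = 2 * (m div 2)" for m :: nat
    by presburger
  show ?thesis
    unfolding set_decode_def mem_Collect_eq odd
    by (intro decidable_not decidable_eq computable_mult computable_div computable_power
        computable_const assms)
qed

text \<open>Membership in, and inclusion of, canonically indexed finite sets are bounded statements,
  since every element of such a set is smaller than its index.\<close>

lemma mem_set_decode_less: "i \<in> set_decode u \<Longrightarrow> i < u"
proof -
  assume "i \<in> set_decode u"
  then have "2 ^ i \<le> u"
    by (auto simp: set_decode_def intro: ccontr)
  then show ?thesis
    using less_exp[of i] by linarith
qed

lemma decidable_set_decode_subset:
  assumes "computable n f" "computable n g"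
  shows "decidable n (\<lambda>xs. set_decode (f xs) \<subseteq> set_decode (g xs))"
proof -
  have "decidable n (\<lambda>xs. \<forall>i\<le>f xs. i \<in> set_decode (f xs) \<longrightarrow> i \<in> set_decode (g xs))"
    by (intro decidable_all_le decidable_imp decidable_mem_set_decode computable_projections
        computable_tl assms)
  then show ?thesis
    by (rule decidable_cong) (auto dest: mem_set_decode_less less_imp_le)
qed

lemmas computable_intros =
  computable_projections computable_const computable_Suc computable_add computable_mult
  computable_power computable_diff computable_div computable_prod_encode computable_If

lemmas decidable_intros =
  decidable_le decidable_eq decidable_not decidable_conj decidable_disj decidable_imp
  decidable_ex_le decidable_all_le decidable_mem_set_decode decidable_set_decode_subset

section \<open>Stagewise evaluation and computably enumerable sets\<close>

text \<open>Evaluation at stage \<open>s\<close>: only unbounded search is cut off, at \<open>s\<close>. The result is shifted by one,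
  0 standing for "undefined", so that it is a total computable function of the stage and the
  arguments. The search stops at the first argument that gives 0 or an undefined value (a shifted
  value of at most 1), and succeeds only if that value is 0.\<close>

fun staged_eval :: "recf \<Rightarrow> nat \<Rightarrow> nat list \<Rightarrow> nat" where
  "staged_eval Zero s xs = Suc 0"
| "staged_eval Succ s xs = (case xs of [x] \<Rightarrow> Suc (Suc x) | _ \<Rightarrow> 0)"
| "staged_eval (Proj i) s xs = (if i < length xs then Suc (xs ! i) else 0)"
| "staged_eval (Comp f gs) s xs =
     (if \<forall>g\<in>set gs. staged_eval g s xs \<noteq> 0
      then staged_eval f s (map (\<lambda>g. staged_eval g s xs - 1) gs) else 0)"
| "staged_eval (PrimRec f g) s xs =
     (case xs of [] \<Rightarrow> 0
      | n # ys \<Rightarrow> rec_nat (staged_eval f s ys)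
          (\<lambda>k r. if r = 0 then 0 else staged_eval g s (k # (r - 1) # ys)) n)"
| "staged_eval (Mu f) s xs =
     (if staged_eval f s ((LEAST k. k = s \<or> staged_eval f s (k # xs) \<le> 1) # xs) = 1
      then Suc (LEAST k. k = s \<or> staged_eval f s (k # xs) \<le> 1) else 0)"

lemma staged_eval_sound: "staged_eval p s xs = Suc v \<Longrightarrow> recf_eval p xs = Some v"
proof (induction p arbitrary: xs v)
  case Succ
  then show ?case by (auto split: list.splits)
next
  case (Comp f gs)
  then have def: "\<forall>g\<in>set gs. staged_eval g s xs \<noteq> 0"
    by (auto split: if_splits)
  have g: "recf_eval g xs = Some (staged_eval g s xs - 1)" if "g \<in> set gs" for g
    using Comp.IH(2)[OF that] def that by force
  have "recf_eval f (map (\<lambda>g. staged_eval g s xs - 1) gs) = Some v"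
    using Comp.IH(1) Comp.prems def by simp
  moreover have "map (\<lambda>g. the (recf_eval g xs)) gs = map (\<lambda>g. staged_eval g s xs - 1) gs"
    using g by simp
  ultimately have "recf_eval f (map (\<lambda>g. the (recf_eval g xs)) gs) = Some v"
    by (simp only:)
  then show ?case
    using g by simp
next
  case (PrimRec f g)
  then obtain n ys where xs: "xs = n # ys"
    by (cases xs) auto
  have "rec_nat (recf_eval f ys)
          (\<lambda>k r. case r of None \<Rightarrow> None | Some v \<Rightarrow> recf_eval g (k # v # ys)) n = Some v"
    if "rec_nat (staged_eval f s ys)
          (\<lambda>k r. if r = 0 then 0 else staged_eval g s (k # (r - 1) # ys)) n = Suc v" for n v
    using that
  proof (induction n arbitrary: v)
    case 0
    then show ?case using PrimRec.IH(1) by simp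
  next
    case (Suc n)
    let ?r = "rec_nat (staged_eval f s ys)
          (\<lambda>k r. if r = 0 then 0 else staged_eval g s (k # (r - 1) # ys)) n"
    from Suc.prems obtain w where w: "?r = Suc w"
      by (cases ?r) auto
    with Suc.prems PrimRec.IH(2)[of "n # w # ys"] Suc.IH[OF w] show ?case
      by simp
  qed
  then show ?case
    using PrimRec.prems xs by simp
next
  case (Mu f)
  let ?P = "\<lambda>k. k = s \<or> staged_eval f s (k # xs) \<le> 1"
  have v: "(LEAST k. ?P k) = v" and zero: "staged_eval f s (v # xs) = 1"
    using Mu.prems by (auto split: if_splits)
  have v0: "recf_eval f (v # xs) = Some 0"
    using Mu.IH zero by simp
  \<comment> \<open>No earlier argument stopped the search, so all earlier values are defined and nonzero.\<close>
  have below: "\<exists>w. recf_eval f (k # xs) = Some (Suc w)" if "k < v" for k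
  proof -
    have "\<not> ?P k"
      using not_less_Least[of k ?P] that v by simp
    then obtain w where "staged_eval f s (k # xs) = Suc (Suc w)"
      by (metis One_nat_def Suc_leI leI Suc_le_D not_less_eq_eq)
    then show ?thesis
      using Mu.IH by blast
  qed
  have "(LEAST k. recf_eval f (k # xs) = Some 0) = v"
    by (intro Least_equality v0) (metis below leI Suc_neq_Zero option.inject)
  then show ?case
    using v0 below by fastforce
qed (auto split: if_splits)

text \<open>Convergence holds at all late enough stages and not just at some stage, so finitely many
  converging computations can be given one common stage.\<close>

lemma staged_eval_complete:
  "recf_eval p xs = Some v \<Longrightarrow> eventually (\<lambda>s. staged_eval p s xs = Suc v) sequentially"
proof (induction p arbitrary: xs v)
  case Succ
  then show ?case by (auto split: list.splits)
next
  case (Comp f gs)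
  then have def: "\<forall>g\<in>set gs. recf_eval g xs \<noteq> None"
    and f: "recf_eval f (map (\<lambda>g. the (recf_eval g xs)) gs) = Some v"
    by (auto split: if_splits)
  have "eventually (\<lambda>s. \<forall>g\<in>set gs. staged_eval g s xs = Suc (the (recf_eval g xs))) sequentially"
    using Comp.IH(2) def by (intro eventually_ball_finite) auto
  moreover note Comp.IH(1)[OF f]
  ultimately show ?case
    by eventually_elim (simp cong: map_cong)
next
  case (PrimRec f g)
  then obtain n ys where xs: "xs = n # ys"
    by (cases xs) auto
  have "eventually (\<lambda>s. rec_nat (staged_eval f s ys)
          (\<lambda>k r. if r = 0 then 0 else staged_eval g s (k # (r - 1) # ys)) n = Suc v) sequentially"
    if "rec_nat (recf_eval f ys)
          (\<lambda>k r. case r of None \<Rightarrow> None | Some v \<Rightarrow> recf_eval g (k # v # ys)) n = Some v" for n v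
    using that
  proof (induction n arbitrary: v)
    case 0
    then show ?case using PrimRec.IH(1) by simp
  next
    case (Suc n)
    then obtain w where w: "rec_nat (recf_eval f ys)
          (\<lambda>k r. case r of None \<Rightarrow> None | Some v \<Rightarrow> recf_eval g (k # v # ys)) n = Some w"
      and g: "recf_eval g (n # w # ys) = Some v"
      by (auto split: option.splits)
    from Suc.IH[OF w] PrimRec.IH(2)[OF g] show ?case
      by eventually_elim simp
  qed
  then show ?case
    using PrimRec.prems xs by simp
next
  case (Mu f)
  then have ex: "\<exists>n. recf_eval f (n # xs) = Some 0 \<and> (\<forall>k<n. recf_eval f (k # xs) \<noteq> None)"
    and v: "v = (LEAST n. recf_eval f (n # xs) = Some 0)"
    by (auto split: if_splits)
  have v0: "recf_eval f (v # xs) = Some 0"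
    unfolding v using ex by (auto intro: LeastI)
  have "\<exists>w. recf_eval f (k # xs) = Some (Suc w)" if "k < v" for k
  proof -
    have "recf_eval f (k # xs) \<noteq> Some 0"
      using not_less_Least that unfolding v by blast
    moreover have "recf_eval f (k # xs) \<noteq> None"
      using ex that Least_le unfolding v by (metis (mono_tags, lifting) order_less_le_trans)
    ultimately show ?thesis
      by (metis not0_implies_Suc option.exhaust)
  qed
  then have "\<forall>k<v. eventually (\<lambda>s. 1 < staged_eval f s (k # xs)) sequentially"
    using Mu.IH by (fastforce elim: eventually_mono)
  then have "eventually (\<lambda>s. \<forall>k\<in>{..<v}. 1 < staged_eval f s (k # xs)) sequentially"
    by (intro eventually_ball_finite) auto
  moreover note Mu.IH[OF v0] eventually_ge_at_top[of v]
  ultimately show ?case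
  proof eventually_elim
    case (elim s)
    have "(LEAST k. k = s \<or> staged_eval f s (k # xs) \<le> 1) = v"
      using elim by (intro Least_equality) (auto simp: not_less[symmetric])
    then show ?case
      using elim by simp
  qed
qed (auto split: if_splits)

lemma computable_staged_eval: "computable (Suc n) (\<lambda>xs. staged_eval p (hd xs) (tl xs))"
proof (induction p arbitrary: n)
  case Zero
  show ?case by (simp add: computable_const)
next
  case Succ
  show ?case
  proof (cases "n = 1")
    case True
    have "computable (Suc n) (\<lambda>xs. Suc (Suc (hd (tl xs))))"
      unfolding True One_nat_def by (intro computable_intros)
    then show ?thesis
      by (rule computable_cong) (auto simp: True length_Suc_conv)
  next
    case False
    show ?thesis
      by (rule computable_cong[OF computable_const[of _ 0]])
        (use False in \<open>auto simp: length_Suc_conv split: list.split\<close>)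
  qed
next
  case (Proj i)
  show ?case
  proof (cases "i < n")
    case True
    then have "computable (Suc n) (\<lambda>xs. Suc (tl xs ! i))"
      by (intro computable_Suc computable_tl computable_nth)
    then show ?thesis
      by (rule computable_cong) (simp add: True)
  next
    case False
    show ?thesis
      by (rule computable_cong[OF computable_const[of _ 0]]) (use False in simp)
  qed
next
  case (Comp f gs)
  have def: "decidable (Suc n) (\<lambda>xs. \<forall>g\<in>set hs. staged_eval g (hd xs) (tl xs) \<noteq> 0)"
    if "set hs \<subseteq> set gs" for hs
    using that
  proof (induction hs)
    case Nil
    have "decidable (Suc n) (\<lambda>xs. (0::nat) = 0)"
      by (intro decidable_eq computable_const)
    then show ?case by simp
  next
    case (Cons h hs)
    then have "decidable (Suc n) (\<lambda>xs. \<not> staged_eval h (hd xs) (tl xs) = 0 \<and>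
        (\<forall>g\<in>set hs. staged_eval g (hd xs) (tl xs) \<noteq> 0))"
      by (intro decidable_conj decidable_not decidable_eq computable_const Comp.IH(2)) auto
    then show ?case by simp
  qed
  have "computable_list (Suc n) (length gs)
      (\<lambda>xs. map (\<lambda>g. staged_eval g (hd xs) (tl xs) - 1) gs)"
    unfolding computable_list_def
    by (auto intro!: computable_diff computable_const Comp.IH(2))
  from computable_comp[OF computable_list_Cons[OF computable_projections(1) this] Comp.IH(1)]
  have "computable (Suc n) (\<lambda>xs. staged_eval f (hd xs)
      (map (\<lambda>g. staged_eval g (hd xs) (tl xs) - 1) gs))"
    by simp
  from computable_If[OF def[OF subset_refl] this computable_const[of _ 0]] show ?case
    by simp
next
  case (PrimRec f g)
  show ?case
  proof (cases n)
    case 0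
    show ?thesis
      by (rule computable_cong[OF computable_const[of _ 0]])
        (auto simp: 0 length_Suc_conv)
  next
    case (Suc m)
    have "computable (Suc n) (\<lambda>xs. staged_eval f (hd xs) (tl (tl xs)))"
      using computable_comp[OF computable_list_Cons[OF computable_projections(1)
          computable_list_tl[OF computable_list_tl[OF computable_list_id]]] PrimRec.IH(1)[of m]]
      by (simp add: Suc)
    moreover have "computable (Suc (Suc (Suc n))) (\<lambda>xs. if hd (tl xs) = 0 then 0
        else staged_eval g (hd (tl (tl xs)))
          (hd xs # (hd (tl xs) - 1) # tl (tl (tl (tl xs)))))" (is "computable _ ?step")
    proof -
      have "computable_list (Suc (Suc (Suc n))) (Suc (Suc (Suc m)))
          (\<lambda>xs. hd (tl (tl xs)) # hd xs # (hd (tl xs) - 1) # tl (tl (tl (tl xs))))"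
        unfolding Suc
        by (intro computable_list_Cons computable_list_tl computable_intros computable_list_id)
      from computable_comp[OF this PrimRec.IH(2)] show ?thesis
        unfolding Suc by (intro computable_If decidable_eq computable_intros) simp
    qed
    ultimately have "computable (Suc n) (\<lambda>xs. rec_nat (staged_eval f (hd xs) (tl (tl xs)))
        (\<lambda>k r. if r = 0 then 0 else staged_eval g (hd xs) (k # (r - 1) # tl (tl xs)))
        (hd (tl xs)))"
      unfolding Suc by (intro computable_rec computable_projections)
    then show ?thesis
      by (rule computable_cong) (auto simp: Suc length_Suc_conv cong: if_cong)
  qed
next
  case (Mu f)
  let ?m = "\<lambda>xs. LEAST k. k = hd xs \<or> staged_eval f (hd xs) (k # tl xs) \<le> 1"
  have "computable (Suc (Suc n)) (\<lambda>xs. staged_eval f (hd (tl xs)) (hd xs # tl (tl xs)))"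
    using computable_comp[OF computable_list_Cons[OF computable_projections(2)
        computable_list_Cons[OF computable_projections(1)
          computable_list_tl[OF computable_list_tl[OF computable_list_id]]]] Mu.IH]
    by simp
  then have m: "computable (Suc n) ?m"
    by (intro computable_Least decidable_disj decidable_eq decidable_le computable_projections
        computable_const) auto
  have "computable (Suc n) (\<lambda>xs. staged_eval f (hd xs) (?m xs # tl xs))"
    using computable_comp[OF computable_list_Cons[OF computable_projections(1)
        computable_list_Cons[OF m computable_list_tl[OF computable_list_id]]] Mu.IH]
    by simp
  then have "computable (Suc n) (\<lambda>xs. if staged_eval f (hd xs) (?m xs # tl xs) = 1
      then Suc (?m xs) else 0)"
    by (intro computable_If decidable_eq computable_const computable_Suc m)
  then show ?case by simp
qed

text \<open>Every c.e. set is the projection of a decidable relation, with witnesses that are stages: all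
  late enough stages witness membership.\<close>

lemma ce_stages:
  assumes "ce W"
  obtains P where "decidable (Suc (Suc 0)) (\<lambda>xs. P (hd xs) (hd (tl xs)))"
    and "\<And>s x. P s x \<Longrightarrow> x \<in> W"
    and "\<And>x. x \<in> W \<Longrightarrow> eventually (\<lambda>s. P s x) sequentially"
proof -
  obtain p where W: "W = {x. recf_eval p [x] \<noteq> None}"
    using assms unfolding ce_def by blast
  show thesis
  proof
    have "computable (Suc (Suc 0)) (\<lambda>xs. staged_eval p (hd xs) [hd (tl xs)])"
      by (rule computable_cong[OF computable_staged_eval]) (auto simp: length_Suc_conv)
    then show "decidable (Suc (Suc 0)) (\<lambda>xs. \<not> staged_eval p (hd xs) [hd (tl xs)] = 0)"
      by (intro decidable_not decidable_eq computable_const)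
    show "x \<in> W" if "\<not> staged_eval p s [x] = 0" for s x
      using staged_eval_sound[of p s "[x]"] that unfolding W
      by (metis (mono_tags, lifting) mem_Collect_eq not0_implies_Suc option.discI)
    show "eventually (\<lambda>s. \<not> staged_eval p s [x] = 0) sequentially" if "x \<in> W" for x
      using that staged_eval_complete[of p "[x]"] unfolding W
      by (force elim: eventually_mono)
  qed
qed

lemma ce_projection:
  assumes "decidable (Suc (Suc 0)) (\<lambda>xs. P (hd xs) (hd (tl xs)))"
  shows "ce {x. \<exists>s. P s x}"
proof -
  obtain f p where f: "\<And>s x. P s x \<longleftrightarrow> f [s, x] = 0"
    and p: "\<And>s x. recf_eval p [s, x] = Some (f [s, x])"
  proof -
    obtain f p where "\<And>xs. length xs = Suc (Suc 0) \<Longrightarrow> P (hd xs) (hd (tl xs)) \<longleftrightarrow> f xs = 0"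
      "\<And>xs. length xs = Suc (Suc 0) \<Longrightarrow> recf_eval p xs = Some (f xs)"
      using assms unfolding decidable_def computable_def by blast
    from this[of "[s, x]" for s x] that[of f p] show thesis
      by simp
  qed
  show ?thesis
    unfolding ce_def by (rule exI[of _ "Mu p"]) (auto simp: f p)
qed

section \<open>Enumeration reducibility\<close>

text \<open>An enumeration operator can be given by a decidable relation \<open>Q s x u\<close>: the axiom that puts \<open>x\<close>
  into the output once \<open>D\<^sub>u\<close> is in the input is enumerated at stage \<open>s\<close>.\<close>

lemma e_leI:
  assumes "decidable (Suc (Suc (Suc 0))) (\<lambda>xs. Q (hd xs) (hd (tl xs)) (hd (tl (tl xs))))"
    and A: "\<And>x. x \<in> A \<longleftrightarrow> (\<exists>u s. Q s x u \<and> set_decode u \<subseteq> B)"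
  shows "A \<le>\<^sub>e B"
proof -
  let ?P = "\<lambda>s e. \<exists>x\<le>e. \<exists>u\<le>e. e = prod_encode (x, u) \<and> Q s x u"
  have Q: "decidable n (\<lambda>xs. Q (f xs) (g xs) (h xs))"
    if "computable n f" "computable n g" "computable n h" for n f g h
    using decidable_comp[OF computable_list_Cons[OF that(1) computable_list_Cons[OF that(2)
          computable_list_Cons[OF that(3) computable_list_Nil]]] assms(1)] by simp
  have "decidable (Suc (Suc 0)) (\<lambda>xs. ?P (hd xs) (hd (tl xs)))"
    by (intro decidable_intros computable_intros Q)
  then have "ce {e. \<exists>s. ?P s e}"
    by (rule ce_projection)
  moreover have "A = enum_op {e. \<exists>s. ?P s e} B"
    unfolding enum_op_def using A le_prod_encode_1 le_prod_encode_2 by (auto; blast)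
  ultimately show ?thesis
    unfolding e_le_def enumeration_operator_def by blast
qed

lemma e_leE:
  assumes "A \<le>\<^sub>e B"
  obtains W where "ce W" "A = enum_op W B"
  using assms unfolding e_le_def enumeration_operator_def by blast

text \<open>The composition puts \<open>x\<close> into the output on seeing \<open>D\<^sub>z\<close> if, for some axiom of the outer operator
  with finite set \<open>D\<^sub>u\<close>, every element of \<open>D\<^sub>u\<close> is enumerated by the inner operator from a subset
  of \<open>D\<^sub>z\<close>. One stage \<open>s\<close> bounds all the searches, which makes this relation decidable; by
  finiteness of \<open>D\<^sub>u\<close> a large enough stage exists.\<close>

lemma e_le_trans:
  assumes "A \<le>\<^sub>e B" "B \<le>\<^sub>e C"
  shows "A \<le>\<^sub>e C"
proof -
  obtain V where V: "ce V" "A = enum_op V B"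
    using assms(1) by (rule e_leE)
  obtain W where W: "ce W" "B = enum_op W C"
    using assms(2) by (rule e_leE)
  obtain P where P: "decidable (Suc (Suc 0)) (\<lambda>xs. P (hd xs) (hd (tl xs)))"
    and P_sound: "\<And>s x. P s x \<Longrightarrow> x \<in> V"
    and P_ev: "\<And>x. x \<in> V \<Longrightarrow> eventually (\<lambda>s. P s x) sequentially"
    using ce_stages[OF V(1)] by metis
  obtain Q where Q: "decidable (Suc (Suc 0)) (\<lambda>xs. Q (hd xs) (hd (tl xs)))"
    and Q_sound: "\<And>s x. Q s x \<Longrightarrow> x \<in> W"
    and Q_ev: "\<And>x. x \<in> W \<Longrightarrow> eventually (\<lambda>s. Q s x) sequentially"
    using ce_stages[OF W(1)] by metis
  let ?R = "\<lambda>s x z. \<exists>u\<le>s. P s (prod_encode (x, u)) \<and> (\<forall>y\<le>u. y \<in> set_decode u \<longrightarrow>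
      (\<exists>w\<le>s. Q s (prod_encode (y, w)) \<and> set_decode w \<subseteq> set_decode z))"
  show ?thesis
  proof (rule e_leI)
    show "decidable (Suc (Suc (Suc 0))) (\<lambda>xs. ?R (hd xs) (hd (tl xs)) (hd (tl (tl xs))))"
      by (intro decidable_intros computable_intros decidable_binary[OF P] decidable_binary[OF Q])
    fix x
    show "x \<in> A \<longleftrightarrow> (\<exists>z s. ?R s x z \<and> set_decode z \<subseteq> C)"
    proof
      assume "x \<in> A"
      then obtain u where u: "prod_encode (x, u) \<in> V" "set_decode u \<subseteq> B"
        unfolding V(2) enum_op_def by blast
      then obtain w where w: "\<And>y. y \<in> set_decode u \<Longrightarrow>
          prod_encode (y, w y) \<in> W \<and> set_decode (w y) \<subseteq> C"
        unfolding W(2) enum_op_def by (simp add: subset_iff) metis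
      define z where "z = set_encode (\<Union>y\<in>set_decode u. set_decode (w y))"
      have z: "set_decode z = (\<Union>y\<in>set_decode u. set_decode (w y))"
        unfolding z_def by (rule set_encode_inverse) (simp add: finite_set_decode)
      have "eventually (\<lambda>s. \<forall>y\<in>set_decode u. w y \<le> s \<and> Q s (prod_encode (y, w y))) sequentially"
        using w by (intro eventually_ball_finite finite_set_decode ballI eventually_conj
            eventually_ge_at_top Q_ev) blast
      moreover have "eventually (\<lambda>s. P s (prod_encode (x, u))) sequentially"
        by (rule P_ev) (rule u)
      moreover note eventually_ge_at_top[of u]
      ultimately have "eventually (\<lambda>s. ?R s x z) sequentially"
        by eventually_elim (use z in blast)
      then obtain s where "?R s x z"
        using eventually_happens'[OF sequentially_bot] by blast
      then show "\<exists>z s. ?R s x z \<and> set_decode z \<subseteq> C"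
        using z w by blast
    next
      assume "\<exists>z s. ?R s x z \<and> set_decode z \<subseteq> C"
      then obtain z s u where "prod_encode (x, u) \<in> V" "set_decode z \<subseteq> C"
        and u: "\<And>y. y \<le> u \<Longrightarrow> y \<in> set_decode u \<Longrightarrow>
          \<exists>w. prod_encode (y, w) \<in> W \<and> set_decode w \<subseteq> set_decode z"
        using P_sound Q_sound by meson
      moreover have "set_decode u \<subseteq> B"
      proof
        fix y assume "y \<in> set_decode u"
        then have "y \<le> u"
          by (simp add: less_imp_le mem_set_decode_less)
        then show "y \<in> B"
          using u[of y] \<open>y \<in> set_decode u\<close> \<open>set_decode z \<subseteq> C\<close> unfolding W(2) enum_op_def by blast
      qed
      ultimately show "x \<in> A"
        unfolding V(2) enum_op_def by blast
    qed
  qed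
qed

lemma set_decode_power [simp]: "set_decode (2 ^ x) = {x}"
  using set_decode_plus_power_2[of x 0] by simp

text \<open>Many-one reducibility implies enumeration reducibility: the singleton of \<open>f x\<close> enumerates \<open>x\<close>.\<close>

lemma e_le_vimage:
  assumes "computable (Suc 0) (\<lambda>xs. f (hd xs))"
  shows "f -` A \<le>\<^sub>e A"
proof (rule e_leI)
  have f: "computable n (\<lambda>xs. f (g xs))" if "computable n g" for n g
    using computable_comp[OF computable_list_Cons[OF that computable_list_Nil] assms] by simp
  show "decidable (Suc (Suc (Suc 0)))
      (\<lambda>xs. hd (tl (tl xs)) = 2 ^ f (hd (tl xs)))"
    by (intro decidable_eq computable_power computable_projections computable_const f)
qed simp

lemma e_le_refl: "A \<le>\<^sub>e A"
  using e_le_vimage[of "\<lambda>x. x" A] by (simp add: computable_projections)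

lemma empty_e_le: "{} \<le>\<^sub>e A"
proof (rule e_leI)
  show "decidable (Suc (Suc (Suc 0))) (\<lambda>_. (0::nat) = 1)"
    by (intro decidable_eq computable_const)
qed simp

lemma e_join_vimage: "(\<lambda>x. 2 * x) -` (A \<oplus>\<^sub>e B) = A" "(\<lambda>x. 2 * x + 1) -` (A \<oplus>\<^sub>e B) = B"
  unfolding e_join_def by (auto, presburger+)

lemma e_le_join1: "A \<le>\<^sub>e A \<oplus>\<^sub>e B"
  by (rule e_le_vimage[of "\<lambda>x. 2 * x" "A \<oplus>\<^sub>e B", unfolded e_join_vimage])
    (intro computable_intros)

lemma e_le_join2: "B \<le>\<^sub>e A \<oplus>\<^sub>e B"
  by (rule e_le_vimage[of "\<lambda>x. 2 * x + 1" "A \<oplus>\<^sub>e B", unfolded e_join_vimage])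
    (intro computable_intros)

lemma mem_e_join: "x \<in> A \<oplus>\<^sub>e B \<longleftrightarrow> (if even x then x div 2 \<in> A else x div 2 \<in> B)"
  unfolding e_join_def by (auto elim!: evenE oddE, presburger+)

text \<open>A cofinite set carries no information: even elements are read off from \<open>A\<close>, while odd ones
  are enumerated outright, a finite exception list being built into the operator.\<close>

lemma e_join_cofinite:
  assumes "finite H"
  shows "A \<oplus>\<^sub>e (- H) \<le>\<^sub>e A"
proof -
  define h where "h = set_encode H"
  have h: "set_decode h = H"
    unfolding h_def using assms by (rule set_encode_inverse)
  show ?thesis
  proof (rule e_leI)
    show "decidable (Suc (Suc (Suc 0))) (\<lambda>xs.
        (hd (tl xs) = 2 * (hd (tl xs) div 2) \<and> hd (tl (tl xs)) = 2 ^ (hd (tl xs) div 2)) \<or>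
        (\<not> hd (tl xs) = 2 * (hd (tl xs) div 2) \<and> hd (tl (tl xs)) = 0 \<and>
          \<not> hd (tl xs) div 2 \<in> set_decode h))"
      by (intro decidable_intros computable_intros)
    fix x :: nat
    have "even x \<longleftrightarrow> x = 2 * (x div 2)"
      by presburger
    then show "x \<in> A \<oplus>\<^sub>e (- H) \<longleftrightarrow> (\<exists>u s.
        ((x = 2 * (x div 2) \<and> u = 2 ^ (x div 2)) \<or>
         (\<not> x = 2 * (x div 2) \<and> u = 0 \<and> \<not> x div 2 \<in> set_decode h)) \<and> set_decode u \<subseteq> A)"
      unfolding mem_e_join h by (cases "even x") (auto simp: set_decode_zero)
  qed
qed

section \<open>Joins with generic sets\<close>

lemma e_join_mono: "R \<subseteq> S \<Longrightarrow> A \<oplus>\<^sub>e R \<subseteq> A \<oplus>\<^sub>e S"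
  by (simp add: subset_iff mem_e_join)

lemma enum_op_mono: "A \<subseteq> B \<Longrightarrow> enum_op W A \<subseteq> enum_op W B"
  unfolding enum_op_def by blast

instance recf :: countable
  by countable_datatype

lemma countable_ce: "countable {W. ce W}"
proof -
  have "{W. ce W} \<subseteq> range (\<lambda>p. {x. recf_eval p [x] \<noteq> None})"
    unfolding ce_def by blast
  then show ?thesis
    by (rule countable_subset) simp
qed

lemma countable_e_lower: "countable {X. X \<le>\<^sub>e Y}"
proof -
  have "{X. X \<le>\<^sub>e Y} \<subseteq> (\<lambda>W. enum_op W Y) ` {W. ce W}"
    by (auto elim: e_leE)
  then show ?thesis
    using countable_ce by (rule countable_subset[OF _ countable_image])
qed

text \<open>The Baire category theorem for Cantor space, in the form of finite conditions: a condition
  \<open>(F, H)\<close> puts \<open>F\<close> into the set under construction and keeps \<open>H\<close> out of it. If each of countably many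
  properties can be forced above any condition, meeting them one after another produces a set
  that has them all.\<close>

lemma generic_set:
  fixes \<Q> :: "(nat set \<Rightarrow> bool) set"
  assumes countable: "countable \<Q>"
    and dense: "\<And>Q F H. Q \<in> \<Q> \<Longrightarrow> finite F \<Longrightarrow> finite H \<Longrightarrow> F \<inter> H = {} \<Longrightarrow>
      \<exists>F' H'. F \<subseteq> F' \<and> H \<subseteq> H' \<and> finite F' \<and> finite H' \<and> F' \<inter> H' = {} \<and>
        (\<forall>R. F' \<subseteq> R \<longrightarrow> R \<inter> H' = {} \<longrightarrow> Q R)"
  shows "\<exists>R. \<forall>Q\<in>\<Q>. Q R"
proof (cases "\<Q> = {}")
  case False
  define q where "q = from_nat_into \<Q>"
  have q: "q n \<in> \<Q>" for n
    unfolding q_def using False by (rule from_nat_into)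
  let ?cond = "\<lambda>(F, H). finite F \<and> finite H \<and> F \<inter> H = ({}::nat set)"
  let ?ext = "\<lambda>n (F, H) (F', H'). F \<subseteq> F' \<and> H \<subseteq> H' \<and>
      (\<forall>R. F' \<subseteq> R \<longrightarrow> R \<inter> H' = {} \<longrightarrow> q n R)"
  have "\<exists>f. \<forall>n. ?cond (f n) \<and> ?ext n (f n) (f (Suc n))"
  proof (rule dependent_nat_choice)
    show "\<exists>x. ?cond x"
      by (rule exI[of _ "({}, {})"]) simp
    show "\<exists>y. ?cond y \<and> ?ext n x y" if "?cond x" for x n
      using dense[OF q[of n], of "fst x" "snd x"] that by (auto split: prod.splits)
  qed
  then obtain f where f: "\<And>n. ?cond (f n) \<and> ?ext n (f n) (f (Suc n))"
    by blast
  define F H where "F n = fst (f n)" and "H n = snd (f n)" for n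
  have disj: "F n \<inter> H n = {}" for n
    using f[of n] by (auto simp: F_def H_def split: prod.splits)
  have step: "F n \<subseteq> F (Suc n)" "H n \<subseteq> H (Suc n)"
    "\<And>R. F (Suc n) \<subseteq> R \<Longrightarrow> R \<inter> H (Suc n) = {} \<Longrightarrow> q n R" for n
    using f[of n] by (auto simp: F_def H_def split: prod.splits)
  have mono: "F m \<subseteq> F n" "H m \<subseteq> H n" if "m \<le> n" for m n
    using that by (auto intro: lift_Suc_mono_le[of F, OF step(1), THEN subsetD]
        lift_Suc_mono_le[of H, OF step(2), THEN subsetD])
  have "F m \<inter> H n = {}" for m n
    using disj[of "max m n"] mono(1)[of m "max m n"] mono(2)[of n "max m n"] by fastforce
  then have "q n (\<Union>m. F m)" for n
    by (intro step(3)) auto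
  moreover have "\<exists>n. q n = Q" if "Q \<in> \<Q>" for Q
    unfolding q_def using from_nat_into_surj[OF countable that] .
  ultimately show ?thesis
    by metis
qed simp

text \<open>Being different from a given set is forced by one more decision. For the second conclusion,
  given \<open>X\<close>, an operator and a condition \<open>(F, H)\<close>, the largest set allowed by the condition is
  the complement of \<open>H\<close>. If the operator sends its join with \<open>A\<close> outside \<open>X\<close>, a wrong element
  is produced already by a finite part, which can be forced. Otherwise no set allowed by the
  condition gives a wrong element, so by monotonicity \<open>X\<close> could only be produced if it equals the
  value at that largest set; but then \<open>X\<close> would be reducible to \<open>A\<close>, as the largest set is
  cofinite.\<close>

lemma generic_join_avoids:
  assumes "countable \<I>" "countable \<X>" "\<And>X. X \<in> \<X> \<Longrightarrow> \<not> X \<le>\<^sub>e A"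
  obtains R where "A \<oplus>\<^sub>e R \<notin> \<I>" "\<And>X. X \<in> \<X> \<Longrightarrow> \<not> X \<le>\<^sub>e A \<oplus>\<^sub>e R"
proof -
  let ?new = "\<lambda>Y R. A \<oplus>\<^sub>e R \<noteq> Y"
  let ?avoid = "\<lambda>(X, W) R. X \<noteq> enum_op W (A \<oplus>\<^sub>e R)"
  let ?Q = "?new ` \<I> \<union> ?avoid ` (\<X> \<times> {W. ce W})"
  have "countable ?Q"
    using assms(1,2) countable_ce by (intro countable_Un countable_image countable_SIGMA) auto
  then have "\<exists>R. \<forall>Q\<in>?Q. Q R"
  proof (rule generic_set)
    fix Q and F H :: "nat set"
    assume Q: "Q \<in> ?Q" and F: "finite F" and H: "finite H" and disj: "F \<inter> H = {}"
    let ?forced = "\<lambda>F' H'. F \<subseteq> F' \<and> H \<subseteq> H' \<and> finite F' \<and> finite H' \<and> F' \<inter> H' = {} \<and>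
      (\<forall>R. F' \<subseteq> R \<longrightarrow> R \<inter> H' = {} \<longrightarrow> Q R)"
    show "\<exists>F' H'. ?forced F' H'"
      using Q
    proof
      assume "Q \<in> ?new ` \<I>"
      then obtain Y where Q_def: "Q = ?new Y"
        by blast
      obtain k where k: "k \<notin> F \<union> H"
        using F H ex_new_if_finite[OF infinite_UNIV_nat, of "F \<union> H"] by auto
      show ?thesis
      \<comment> \<open>The condition leaves \<open>k\<close> undecided, so the join can be made to differ from \<open>Y\<close> at \<open>2 * k + 1\<close>.\<close>
      proof (cases "2 * k + 1 \<in> Y")
        case True
        then have "?forced F (insert k H)"
          using F H disj k unfolding Q_def by (auto simp: mem_e_join)
        then show ?thesis by (intro exI)
      next
        case False
        then have "?forced (insert k F) H"
          using F H disj k unfolding Q_def by (auto simp: mem_e_join)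
        then show ?thesis by (intro exI)
      qed
    next
      assume "Q \<in> ?avoid ` (\<X> \<times> {W. ce W})"
      then obtain X W where X: "X \<in> \<X>" and W: "ce W" and Q_def: "Q = ?avoid (X, W)"
        by blast
      show ?thesis
      proof (cases "enum_op W (A \<oplus>\<^sub>e (- H)) \<subseteq> X")
        case True
        have "X \<noteq> enum_op W (A \<oplus>\<^sub>e R)" if "R \<inter> H = {}" for R
        proof
          assume eq: "X = enum_op W (A \<oplus>\<^sub>e R)"
          have "R \<subseteq> - H"
            using that by blast
          then have "X \<subseteq> enum_op W (A \<oplus>\<^sub>e (- H))"
            unfolding eq by (intro enum_op_mono e_join_mono)
          with True have "X \<le>\<^sub>e A \<oplus>\<^sub>e (- H)"
            using W unfolding e_le_def enumeration_operator_def by blast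
          then show False
            using e_le_trans e_join_cofinite[OF H] assms(3)[OF X] by blast
        qed
        then have "?forced F H"
          using F H disj unfolding Q_def by auto
        then show ?thesis by (intro exI)
      next
        case False
        then obtain x u where x: "x \<notin> X" and u: "prod_encode (x, u) \<in> W"
          "set_decode u \<subseteq> A \<oplus>\<^sub>e (- H)"
          unfolding enum_op_def by blast
        let ?F = "F \<union> {k. 2 * k + 1 \<in> set_decode u}"
        have "finite {k. 2 * k + 1 \<in> set_decode u}"
          using finite_vimageI[OF finite_set_decode[of u], of "\<lambda>k. 2 * k + 1"]
          by (simp add: vimage_def inj_on_def)
        moreover have "{k. 2 * k + 1 \<in> set_decode u} \<inter> H = {}"
          using subsetD[OF u(2), of "2 * k + 1" for k] by (auto simp: mem_e_join simp del: set_decode_Suc)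
        moreover have "X \<noteq> enum_op W (A \<oplus>\<^sub>e R)" if "?F \<subseteq> R" for R
        proof -
          have "set_decode u \<subseteq> A \<oplus>\<^sub>e R"
          proof
            fix y assume y: "y \<in> set_decode u"
            show "y \<in> A \<oplus>\<^sub>e R"
            proof (cases "even y")
              case True
              then show ?thesis using y u(2) by (auto simp: mem_e_join)
            next
              case False
              then have "y = 2 * (y div 2) + 1" by presburger
              then have "y div 2 \<in> {k. 2 * k + 1 \<in> set_decode u}"
                using y by (metis mem_Collect_eq)
              then have "y div 2 \<in> R" using that by blast
              then show ?thesis using False by (simp add: mem_e_join)
            qed
          qed
          then have "x \<in> enum_op W (A \<oplus>\<^sub>e R)"
            using u(1) unfolding enum_op_def by blast
          then show ?thesis using x by blast
        qed
        ultimately have "?forced ?F H"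
          using F H disj unfolding Q_def by auto
        then show ?thesis by (intro exI)
      qed
    qed
  qed
  then obtain R where R: "\<forall>Q\<in>?Q. Q R"
    by (rule exE)
  show thesis
  proof
    have "A \<oplus>\<^sub>e R \<noteq> Y" if "Y \<in> \<I>" for Y
      using bspec[OF R UnI1[OF imageI[OF that]]] .
    then show "A \<oplus>\<^sub>e R \<notin> \<I>"
      by blast
    show "\<not> X \<le>\<^sub>e A \<oplus>\<^sub>e R" if "X \<in> \<X>" for X
    proof
      assume "X \<le>\<^sub>e A \<oplus>\<^sub>e R"
      then obtain W where W: "ce W" "X = enum_op W (A \<oplus>\<^sub>e R)"
        by (rule e_leE)
      have "?avoid (X, W) \<in> ?avoid ` (\<X> \<times> {W. ce W})"
        by (rule imageI) (simp add: that W(1))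
      from bspec[OF R UnI2[OF this]] W(2) show False
        by simp
    qed
  qed
qed

section \<open>Meeting the demands of a splitting class\<close>

lemma e_equiv_trans: "X \<equiv>\<^sub>e Y \<Longrightarrow> Y \<equiv>\<^sub>e Z \<Longrightarrow> X \<equiv>\<^sub>e Z"
  unfolding e_equiv_def using e_le_trans by blast

text \<open>The approximations to the pair that is to be constructed: the first component is kept inside
  the splitting class, the second outside of it.\<close>

definition separated :: "nat set set \<times> nat set set \<Rightarrow> bool" where
  "separated P \<longleftrightarrow> (case P of (\<I>, \<G>) \<Rightarrow>
     countable \<I> \<and> e_downward_closed \<I> \<and> \<I> \<noteq> {} \<and>
     countable \<G> \<and> e_equiv_closed \<G> \<and> \<I> \<inter> \<G> = {})"

definition extends :: "nat set set \<times> nat set set \<Rightarrow> nat set set \<times> nat set set \<Rightarrow> bool"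
  (infix "\<sqsubseteq>" 50) where
  "P \<sqsubseteq> P' \<longleftrightarrow> fst P \<subseteq> fst P' \<and> snd P \<subseteq> snd P'"

text \<open>An instance of the splitting property that a class has to satisfy. Membership
  in the class occurs in it only positively, so it remains an instance for every larger class.\<close>

definition demands :: "nat set set \<Rightarrow> (nat set \<times> nat set set) set" where
  "demands \<I> = {(A, \<B>). A \<in> \<I> \<and> finite \<B> \<and> \<B> \<subseteq> {B \<in> \<I>. \<not> B \<le>\<^sub>e A}}"

text \<open>Meeting a demand includes a promise for the future: the joins are put into the second
  component and therefore stay out of all later first components.\<close>

definition meets :: "nat set set \<times> nat set set \<Rightarrow> nat set \<times> nat set set \<Rightarrow> bool" where
  "meets P t \<longleftrightarrow> (\<exists>C\<in>fst P. fst t <\<^sub>e C \<and> (\<forall>B\<in>snd t. B \<oplus>\<^sub>e C \<in> snd P))"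

lemma extends_refl: "P \<sqsubseteq> P"
  by (simp add: extends_def)

lemma extends_trans: "P \<sqsubseteq> P' \<Longrightarrow> P' \<sqsubseteq> P'' \<Longrightarrow> P \<sqsubseteq> P''"
  unfolding extends_def by blast

lemma meets_mono: "meets P t \<Longrightarrow> P \<sqsubseteq> P' \<Longrightarrow> meets P' t"
  unfolding meets_def extends_def by blast

lemma countable_demands:
  assumes "countable \<I>"
  shows "countable (demands \<I>)"
proof -
  have "demands \<I> \<subseteq> \<I> \<times> {\<B>. finite \<B> \<and> \<B> \<subseteq> \<I>}"
    unfolding demands_def by blast
  then show ?thesis
    by (rule countable_subset)
      (intro countable_SIGMA countable_Collect_finite_subset assms)
qed

text \<open>Take \<open>C\<close> to be the join of \<open>A\<close> with a generic set and add the lower cone of \<open>C\<close> to the first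
  component and the degrees of all \<open>B \<oplus>\<^sub>e C\<close> to the second. No member of the old second component
  and no \<open>B\<close> lies below \<open>A\<close>, hence none lies below \<open>C\<close>. So the lower cone of \<open>C\<close> misses the
  old second component, and \<open>B \<oplus>\<^sub>e C\<close> is in the new first component neither by being below \<open>C\<close>
  (then \<open>B\<close> would be below \<open>C\<close>) nor by being in the old one (then \<open>C\<close> would be in it).\<close>

lemma meet_demand:
  assumes sep: "separated P" and t: "t \<in> demands (fst P)"
  obtains P' where "separated P'" "P \<sqsubseteq> P'" "meets P' t"
proof -
  obtain \<I> \<G> A \<B> where P: "P = (\<I>, \<G>)" and t_def: "t = (A, \<B>)"
    by (metis surj_pair)
  have \<I>: "countable \<I>" "\<I> \<noteq> {}" "\<I> \<inter> \<G> = {}" and \<G>: "countable \<G>"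
    and down: "\<And>X Y. X \<le>\<^sub>e Y \<Longrightarrow> Y \<in> \<I> \<Longrightarrow> X \<in> \<I>"
    and equiv: "\<And>X Y. X \<equiv>\<^sub>e Y \<Longrightarrow> Y \<in> \<G> \<Longrightarrow> X \<in> \<G>"
    using sep unfolding separated_def P e_downward_closed_def e_equiv_closed_def by auto
  have A: "A \<in> \<I>" and \<B>: "finite \<B>" "\<And>B. B \<in> \<B> \<Longrightarrow> \<not> B \<le>\<^sub>e A"
    using t unfolding demands_def t_def P by auto
  have "countable (\<G> \<union> \<B>)"
    using \<G> \<B>(1) by (simp add: countable_finite)
  moreover have "\<not> X \<le>\<^sub>e A" if "X \<in> \<G> \<union> \<B>" for X
    using that \<B>(2) down[OF _ A] \<I>(3) by blast
  ultimately obtain R where R: "A \<oplus>\<^sub>e R \<notin> \<I>" "\<And>X. X \<in> \<G> \<union> \<B> \<Longrightarrow> \<not> X \<le>\<^sub>e A \<oplus>\<^sub>e R"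
    using generic_join_avoids[OF \<I>(1)] by metis
  define C where "C = A \<oplus>\<^sub>e R"
  define \<I>' where "\<I>' = \<I> \<union> {X. X \<le>\<^sub>e C}"
  define \<G>' where "\<G>' = \<G> \<union> (\<Union>B\<in>\<B>. {X. X \<equiv>\<^sub>e B \<oplus>\<^sub>e C})"
  have "countable {X. X \<equiv>\<^sub>e Y}" for Y
    by (rule countable_subset[OF _ countable_e_lower[of Y]]) (auto simp: e_equiv_def)
  then have "countable \<G>'"
    unfolding \<G>'_def using \<G> \<B>(1) by (simp add: countable_finite)
  moreover have "countable \<I>'"
    unfolding \<I>'_def using \<I>(1) countable_e_lower by simp
  moreover have "e_downward_closed \<I>'"
    unfolding \<I>'_def e_downward_closed_def using down e_le_trans by blast
  moreover have "e_equiv_closed \<G>'"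
    unfolding \<G>'_def e_equiv_closed_def using equiv e_equiv_trans by blast
  moreover have "X \<notin> \<G>'" if X: "X \<in> \<I>'" for X
  proof
    assume "X \<in> \<G>'"
    then consider "X \<in> \<G>" | B where "B \<in> \<B>" "B \<oplus>\<^sub>e C \<le>\<^sub>e X"
      unfolding \<G>'_def e_equiv_def by blast
    then show False
    proof cases
      case 1
      then show False
        using X \<I>(3) R(2) unfolding \<I>'_def C_def by blast
    next
      case (2 B)
      then have "\<not> X \<le>\<^sub>e C"
        using R(2)[of B] e_le_trans[OF e_le_join1] e_le_trans unfolding C_def by blast
      moreover have "X \<notin> \<I>"
        using R(1) down e_le_trans[OF e_le_join2 2(2)] unfolding C_def by blast
      ultimately show False
        using X unfolding \<I>'_def by blast
    qed
  qed
  ultimately have "separated (\<I>', \<G>')"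
    unfolding separated_def using \<I>(2) unfolding \<I>'_def by auto
  moreover have "P \<sqsubseteq> (\<I>', \<G>')"
    unfolding P extends_def \<I>'_def \<G>'_def by auto
  moreover have "A <\<^sub>e C"
    unfolding e_less_def using e_le_join1 down[OF _ A] R(1) unfolding C_def by blast
  then have "meets (\<I>', \<G>') t"
    unfolding meets_def t_def \<I>'_def \<G>'_def e_equiv_def using e_le_refl by auto
  ultimately show thesis
    by (rule that)
qed

lemma separated_chain_union:
  assumes sep: "\<And>n. separated (f n)" and chain: "\<And>n. f n \<sqsubseteq> f (Suc n)"
  defines "U \<equiv> (\<Union>n. fst (f n), \<Union>n. snd (f n))"
  shows "separated U" "\<And>n. f n \<sqsubseteq> U"
proof -
  have mono: "fst (f m) \<subseteq> fst (f n)" "snd (f m) \<subseteq> snd (f n)" if "m \<le> n" for m n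
    using lift_Suc_mono_le[of "\<lambda>n. fst (f n)", OF _ that]
      lift_Suc_mono_le[of "\<lambda>n. snd (f n)", OF _ that] chain
    by (simp_all add: extends_def)
  have f: "countable (fst (f n))" "e_downward_closed (fst (f n))" "fst (f n) \<noteq> {}"
    "countable (snd (f n))" "e_equiv_closed (snd (f n))" "fst (f n) \<inter> snd (f n) = {}" for n
    using sep[of n] by (auto simp: separated_def split: prod.splits)
  have "fst (f m) \<inter> snd (f n) = {}" for m n
    using f(6)[of "max m n"] mono(1)[of m "max m n"] mono(2)[of n "max m n"] by fastforce
  moreover have "e_downward_closed (\<Union>n. fst (f n))"
    using f(2) unfolding e_downward_closed_def by blast
  moreover have "e_equiv_closed (\<Union>n. snd (f n))"
    using f(5) unfolding e_equiv_closed_def by blast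
  ultimately show "separated U"
    unfolding separated_def U_def using f(1,3,4) by auto
  show "f n \<sqsubseteq> U" for n
    unfolding extends_def U_def by auto
qed

text \<open>All demands of the initial class are met along a chain of length \<open>\<omega>\<close>. Later members of the
  chain create new demands; these are left to a second iteration.\<close>

lemma meet_all_demands:
  assumes sep: "separated P"
  obtains P' where "separated P'" "P \<sqsubseteq> P'" "\<And>t. t \<in> demands (fst P) \<Longrightarrow> meets P' t"
proof -
  define t where "t = from_nat_into (demands (fst P))"
  obtain A where "A \<in> fst P"
    using sep unfolding separated_def by auto
  then have "(A, {}) \<in> demands (fst P)"
    unfolding demands_def by simp
  then have "demands (fst P) \<noteq> {}"
    by blast
  then have t: "t n \<in> demands (fst P)" for n
    unfolding t_def by (rule from_nat_into)
  have count: "countable (demands (fst P))"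
    using sep by (intro countable_demands) (auto simp: separated_def)
  have "\<exists>f. \<forall>n. (separated (f n) \<and> P \<sqsubseteq> f n) \<and> (f n \<sqsubseteq> f (Suc n) \<and> meets (f (Suc n)) (t n))"
  proof (rule dependent_nat_choice)
    show "\<exists>Q. separated Q \<and> P \<sqsubseteq> Q"
      using sep extends_refl by blast
    show "\<exists>Q'. (separated Q' \<and> P \<sqsubseteq> Q') \<and> (Q \<sqsubseteq> Q' \<and> meets Q' (t n))"
      if "separated Q \<and> P \<sqsubseteq> Q" for Q n
    proof -
      have "t n \<in> demands (fst Q)"
        using t[of n] that unfolding demands_def extends_def by auto
      then show ?thesis
        using meet_demand[of Q "t n"] that extends_trans by metis
    qed
  qed
  then obtain f where f: "\<And>n. separated (f n)" "\<And>n. P \<sqsubseteq> f n" "\<And>n. f n \<sqsubseteq> f (Suc n)"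
    "\<And>n. meets (f (Suc n)) (t n)"
    by blast
  let ?U = "(\<Union>n. fst (f n), \<Union>n. snd (f n))"
  note U = separated_chain_union[of f, OF f(1,3)]
  show thesis
  proof
    show "separated ?U"
      by (rule U(1))
    show "P \<sqsubseteq> ?U"
      by (rule extends_trans[OF f(2) U(2)])
    show "meets ?U s" if s: "s \<in> demands (fst P)" for s
    proof -
      obtain n where "t n = s"
        using from_nat_into_surj[OF count s] unfolding t_def by blast
      then show ?thesis
        using meets_mono[OF f(4) U(2)] by blast
    qed
  qed
qed

text \<open>A demand of the limit class mentions finitely many sets, so it is a demand of some member of
  the chain and is met by the next.\<close>

lemma extends_to_splitting_class:
  assumes "separated P"
  obtains \<I>' \<G>' where "separated (\<I>', \<G>')" "P \<sqsubseteq> (\<I>', \<G>')" "splitting_class \<I>'"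
proof -
  have "\<exists>f. \<forall>n. (separated (f n) \<and> P \<sqsubseteq> f n) \<and>
      (f n \<sqsubseteq> f (Suc n) \<and> (\<forall>t\<in>demands (fst (f n)). meets (f (Suc n)) t))"
  proof (rule dependent_nat_choice)
    show "\<exists>Q. separated Q \<and> P \<sqsubseteq> Q"
      using assms extends_refl by blast
    show "\<exists>Q'. (separated Q' \<and> P \<sqsubseteq> Q') \<and> (Q \<sqsubseteq> Q' \<and> (\<forall>t\<in>demands (fst Q). meets Q' t))"
      if "separated Q \<and> P \<sqsubseteq> Q" for Q and n :: nat
      using meet_all_demands[of Q] that extends_trans by metis
  qed
  then obtain f where f: "\<And>n. separated (f n)" "\<And>n. P \<sqsubseteq> f n" "\<And>n. f n \<sqsubseteq> f (Suc n)"
    "\<And>n t. t \<in> demands (fst (f n)) \<Longrightarrow> meets (f (Suc n)) t"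
    by blast
  let ?I = "\<Union>n. fst (f n)" and ?G = "\<Union>n. snd (f n)"
  note U = separated_chain_union[of f, OF f(1,3)]
  have mono: "fst (f m) \<subseteq> fst (f n)" if "m \<le> n" for m n
    using lift_Suc_mono_le[of "\<lambda>n. fst (f n)", OF _ that] f(3) by (simp add: extends_def)
  have met: "meets (?I, ?G) t" if "t \<in> demands ?I" for t
  proof -
    obtain A \<B> where t: "t = (A, \<B>)" "A \<in> ?I" "finite \<B>" "\<B> \<subseteq> ?I" "\<And>B. B \<in> \<B> \<Longrightarrow> \<not> B \<le>\<^sub>e A"
      using \<open>t \<in> demands ?I\<close> unfolding demands_def by blast
    have "fst (f m) \<subseteq> fst (f n) \<or> fst (f n) \<subseteq> fst (f m)" for m n
      using mono nat_le_linear[of m n] by blast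
    then have chain: "subset.chain UNIV (range (\<lambda>n. fst (f n)))"
      unfolding subset_chain_def by simp
    have "insert A \<B> \<subseteq> \<Union>(range (\<lambda>n. fst (f n)))" "finite (insert A \<B>)"
      using t by auto
    then obtain Y where "Y \<in> range (\<lambda>n. fst (f n))" "insert A \<B> \<subseteq> Y"
      using finite_subset_Union_chain[OF _ _ _ chain] by blast
    then obtain n where "insert A \<B> \<subseteq> fst (f n)"
      by blast
    then have "t \<in> demands (fst (f n))"
      using t unfolding demands_def by auto
    then show ?thesis
      by (rule meets_mono[OF f(4) U(2)])
  qed
  have "splitting_class ?I"
    unfolding splitting_class_def
  proof (intro conjI ballI allI impI)
    show "?I \<noteq> {}" "countable ?I" "e_downward_closed ?I"
      using U(1) unfolding separated_def by auto
    fix A \<B> assume "A \<in> ?I" "finite \<B> \<and> \<B> \<subseteq> {B \<in> ?I. \<not> B \<le>\<^sub>e A}"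
    then have "meets (?I, ?G) (A, \<B>)"
      by (intro met) (auto simp: demands_def)
    moreover have "?I \<inter> ?G = {}"
      using U(1) unfolding separated_def by auto
    ultimately show "\<exists>C\<in>?I. A <\<^sub>e C \<and> (\<forall>B\<in>\<B>. B \<oplus>\<^sub>e C \<notin> ?I)"
      unfolding meets_def fst_conv snd_conv by (meson disjoint_iff)
  qed
  then show thesis
    using that U(1) extends_trans[OF f(2) U(2)] by blast
qed

theorem theorem5p11:
  fixes \<I> \<G> :: "nat set set"
  assumes "countable \<I>" and "e_downward_closed \<I>"
    and "\<G> \<subseteq> - \<I>" and "countable \<G>" and "e_equiv_closed \<G>"
    and "\<I> = {} \<Longrightarrow> {} \<notin> \<G>"
  shows "\<exists>\<I>\<^sub>f \<G>\<^sub>f. countable \<I>\<^sub>f \<and> countable \<G>\<^sub>f \<and> \<I> \<subseteq> \<I>\<^sub>f \<and> \<G> \<subseteq> \<G>\<^sub>f \<and>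
    e_downward_closed \<I>\<^sub>f \<and> e_equiv_closed \<G>\<^sub>f \<and> \<G>\<^sub>f \<subseteq> - \<I>\<^sub>f \<and> splitting_class \<I>\<^sub>f"
proof -
  \<comment> \<open>The iteration needs a nonempty class, so the least degree is added first, which must not meet \<open>\<G>\<close>.\<close>
  have "{} \<notin> \<G>"
  proof (cases "\<I> = {}")
    case False
    then have "{} \<in> \<I>"
      using assms(2) empty_e_le unfolding e_downward_closed_def by blast
    then show ?thesis
      using assms(3) by blast
  qed (rule assms(6))
  moreover have "{} \<equiv>\<^sub>e X" if "X \<le>\<^sub>e {}" for X
    using that empty_e_le unfolding e_equiv_def by blast
  ultimately have "X \<notin> \<G>" if "X \<le>\<^sub>e {}" for X
    using that assms(5) unfolding e_equiv_closed_def by blast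
  moreover have "e_downward_closed (\<I> \<union> {X. X \<le>\<^sub>e {}})"
    using assms(2) e_le_trans unfolding e_downward_closed_def by blast
  ultimately have "separated (\<I> \<union> {X. X \<le>\<^sub>e {}}, \<G>)"
    using assms(1,3,4,5) countable_e_lower e_le_refl[of "{}"] unfolding separated_def by auto
  then obtain \<I>' \<G>' where "separated (\<I>', \<G>')" "(\<I> \<union> {X. X \<le>\<^sub>e {}}, \<G>) \<sqsubseteq> (\<I>', \<G>')"
    "splitting_class \<I>'"
    by (rule extends_to_splitting_class)
  then show ?thesis
    unfolding separated_def extends_def by (intro exI[of _ \<I>'] exI[of _ \<G>']) auto
qed

end
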